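(* Let $\Omega=\mathbb{D}$ or $\Omega=\mathbb{R}^2\setminus\mathbb{D}$, and let $u,v$ be real-valued functions on $\Omega$ satisfying $$-\triangle u=\frac{2u\,v_{x^1}^2+2u\,v_{x^2}^2-2u_{x^1}v_{x^1}v-2u_{x^2}v_{x^2}v}{1+u^2+v^2},$$ $$-\triangle v=\frac{2v\,u_{x^1}^2+2v\,u_{x^2}^2-2u_{x^1}v_{x^1}u-2u_{x^2}v_{x^2}u}{1+u^2+v^2},$$ together with the minimal conditions (a) $|u|^2|\nabla v|^2=|v|^2|\nabla u|^2$, and (b) $\nabla u$ and $\nabla v$ are linearly dependent. Then $$\triangle u=0,\qquad \triangle v=0,$$ except on a measure zero set $\mathcal{Z}:=\{x: u(x)=0\ \text{or}\ v(x)=0\}$.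
   Context: $\mathbb{D}$ is the open unit disk in $\mathbb{R}^2$ with coordinates $(x^1,x^2)$; subscripts $x^i$ denote partial derivatives, and $\nabla,\triangle$ are the Euclidean gradient and Laplacian. The functions $u,v$ are regular enough (twice differentiable) for the equations to make sense.
   Formalization: That Z has measure zero is asserted only when neither u nor v vanishes identically on Ω; otherwise it fails (u=0, v=1 satisfies every condition and Z=Ω). The vanishing of the Laplacians off Z is asserted without this restriction. *)

theory Defs
  imports "HOL-Analysis.Analysis"
begin

text \<open>
  Derivatives are taken within \<open>S\<close>, so that they are meaningful for a function that matters
  only on \<open>S\<close>, also at the boundary points of the closed set \<open>- ball 0 1\<close>.
  On the open disk they are the usual derivatives; on both domains the derivative
  within the set is unique, see \<open>pd_eqI\<close> below.
\<close>

definition pd :: "(real^2) set \<Rightarrow> 2 \<Rightarrow> (real^2 \<Rightarrow> real) \<Rightarrow> real^2 \<Rightarrow> real" where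
  "pd S i f x = frechet_derivative f (at x within S) (axis i 1)"

definition grad :: "(real^2) set \<Rightarrow> (real^2 \<Rightarrow> real) \<Rightarrow> real^2 \<Rightarrow> real^2" where
  "grad S f x = (\<chi> i. pd S i f x)"

definition laplacian :: "(real^2) set \<Rightarrow> (real^2 \<Rightarrow> real) \<Rightarrow> real^2 \<Rightarrow> real" where
  "laplacian S f x = (\<Sum>i\<in>UNIV. pd S i (pd S i f) x)"

definition twice_differentiable_on :: "(real^2 \<Rightarrow> real) \<Rightarrow> (real^2) set \<Rightarrow> bool" where
  "twice_differentiable_on f S \<longleftrightarrow>
     f differentiable_on S \<and> (\<forall>i. pd S i f differentiable_on S)"

text \<open>The library predicate \<open>dependent\<close> is about sets, and \<open>{a, b}\<close> collapses for \<open>a = b\<close>.\<close>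

definition lin_dep_pair :: "'a::real_vector \<Rightarrow> 'a \<Rightarrow> bool" where
  "lin_dep_pair a b \<longleftrightarrow> (\<exists>s t. (s \<noteq> 0 \<or> t \<noteq> 0) \<and> s *\<^sub>R a + t *\<^sub>R b = 0)"

lemma pd_eqI:
  assumes S: "S = ball 0 1 \<or> S = - ball 0 1" and x: "x \<in> S"
    and D: "(f has_derivative D) (at x within S)"
  shows "pd S i f x = D (axis i 1)"
proof -
  have *: "\<exists>d. 0 < \<bar>d\<bar> \<and> \<bar>d\<bar> < e \<and> x + d *\<^sub>R b \<in> S" if b: "b \<in> Basis" and e: "e > 0" for b e
    using S
  proof
    assume "S = ball 0 1"
    then have "open S" by simp
    then obtain r where r: "r > 0" "ball x r \<subseteq> S"
      using x open_contains_ball by blast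
    define d where "d = min r e / 2"
    have "0 < d" "d < r" "d < e"
      using r e by (auto simp: d_def min_def)
    moreover from this have "x + d *\<^sub>R b \<in> ball x r"
      using b by (simp add: dist_norm)
    ultimately show ?thesis
      using r by (intro exI[of _ d]) auto
  next
    assume SS: "S = - ball 0 1"
    define d where "d = (if x \<bullet> b \<ge> 0 then e / 2 else - e / 2)"
    have d: "0 < \<bar>d\<bar>" "\<bar>d\<bar> < e" "d * (x \<bullet> b) \<ge> 0"
      using e by (auto simp: d_def mult_le_0_iff)
    have "(norm (x + d *\<^sub>R b))\<^sup>2 = (norm x)\<^sup>2 + 2 * (d * (x \<bullet> b)) + d\<^sup>2"
      using b unfolding power2_norm_eq_inner
      by (simp add: inner_simps inner_commute power2_eq_square algebra_simps)
    then have "(norm x)\<^sup>2 \<le> (norm (x + d *\<^sub>R b))\<^sup>2"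
      using d by simp
    then have "norm x \<le> norm (x + d *\<^sub>R b)"
      by (rule power2_le_imp_le) simp
    then have "x + d *\<^sub>R b \<in> S"
      using x SS by auto
    with d show ?thesis by blast
  qed
  have "(f has_derivative frechet_derivative f (at x within S)) (at x within S)"
    using D differentiableI frechet_derivative_works by blast
  then have "frechet_derivative f (at x within S) = D"
    using D * by (rule frechet_derivative_unique_within)
  then show ?thesis
    by (simp add: pd_def)
qed

end

theory Submission
  imports Defs "HOL-Complex_Analysis.Complex_Analysis"
begin

text \<open>
  With \<open>W = 1 + u\<^sup>2 + v\<^sup>2\<close> the two equations read
  \<open>W \<triangle>u = -2 \<nabla>v \<bullet> (u \<nabla>v - v \<nabla>u)\<close> and \<open>W \<triangle>v = -2 \<nabla>u \<bullet> (v \<nabla>u - u \<nabla>v)\<close>,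
  so both functions are harmonic as soon as \<open>u \<nabla>v = v \<nabla>u\<close>. Conditions (a) and (b) say
  that at each point \<open>u \<nabla>v = v \<nabla>u\<close> or \<open>u \<nabla>v = - v \<nabla>u\<close> (\<open>grad_dichotomy\<close>), and the
  second sign turns out to give nothing new. Suppose that the first equation fails at \<open>x\<close>.
  By continuity it fails near \<open>x\<close>, so \<open>u \<nabla>v + v \<nabla>u = 0\<close> near \<open>x\<close>, and the divergence of
  this field vanishes at \<open>x\<close>: \<open>2 \<nabla>u \<bullet> \<nabla>v + u \<triangle>v + v \<triangle>u = 0\<close>. The equations have become
  \<open>W \<triangle>u = -4 u |\<nabla>v|\<^sup>2\<close> and \<open>W \<triangle>v = -4 v |\<nabla>u|\<^sup>2\<close>, whence
  \<open>W \<nabla>u \<bullet> \<nabla>v = 2 u v (|\<nabla>u|\<^sup>2 + |\<nabla>v|\<^sup>2)\<close>. After multiplication by \<open>u v\<close> the right side is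
  nonnegative, while the left side is \<open>- W v\<^sup>2 |\<nabla>u|\<^sup>2\<close>. Hence \<open>v \<nabla>u = 0\<close>, thus also
  \<open>u \<nabla>v = 0\<close>, a contradiction. Both Laplacians therefore vanish on all of \<open>\<Omega>\<close>.

  It remains to see that a harmonic function \<open>w\<close> on a connected open set, not identically zero,
  has a null zero set (\<open>negligible_zeros_harmonic\<close>). Its complex gradient
  \<open>f = w\<^sub>x - \<i> w\<^sub>y\<close> is holomorphic: of the two Cauchy-Riemann equations one is Laplace's
  equation and the other is the symmetry of the mixed second derivatives, which here must be
  available for a function that is twice differentiable without its second derivatives being
  continuous (\<open>second_derivative_symmetric\<close>). The zeros of \<open>f\<close> are countable
  unless \<open>w\<close> is constant. Near any other zero of \<open>w\<close> one has \<open>w = Re F\<close> with \<open>F' = f \<noteq> 0\<close>, so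
  the zero set is the image of part of the imaginary axis under a local inverse of \<open>F\<close>, which
  is null (\<open>negligible_regular_zeros_Re\<close>). For the closed exterior of the disk this applies to
  the interior, and the boundary circle is null.
\<close>

section \<open>Symmetry of second derivatives\<close>

text \<open>
  The increment of \<open>t \<mapsto> f (a + t v + h w) - f (a + t v)\<close> over \<open>[0, h]\<close> is, by the mean value
  theorem, \<open>h\<close> times a difference of two values of \<open>x \<mapsto> D x v\<close> near \<open>a\<close>. Differentiability of
  this function at the single point \<open>a\<close> makes that difference equal to \<open>h * P w\<close> up to
  \<open>o(h)\<close>. The numerator of the quotient is symmetric in \<open>v\<close> and \<open>w\<close>, which is all that the
  symmetry of second derivatives needs.
\<close>

lemma second_difference_tendsto:
  fixes f :: "'a::real_normed_vector \<Rightarrow> real"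
  assumes U: "open U" "a \<in> U"
    and f: "\<And>x. x \<in> U \<Longrightarrow> (f has_derivative D x) (at x)"
    and P: "((\<lambda>x. D x v) has_derivative P) (at a)"
  shows "((\<lambda>h. (f (a + h *\<^sub>R v + h *\<^sub>R w) - f (a + h *\<^sub>R v) - f (a + h *\<^sub>R w) + f a) / h\<^sup>2)
           \<longlongrightarrow> P w) (at_right 0)"
proof (rule tendstoI)
  fix e :: real assume e: "e > 0"
  \<comment> \<open>All points used lie within \<open>h * K\<close> of \<open>a\<close>; two of them enter the estimate, each with
    error \<open>\<epsilon> * (h * K)\<close>, which together make \<open>h * e / 2\<close>.\<close>
  define K where "K = norm v + norm w + 1"
  have K: "K > 0" by (simp add: K_def add_nonneg_pos)
  define \<epsilon> where "\<epsilon> = e / (4 * K)"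
  have \<epsilon>: "\<epsilon> > 0" using e K by (simp add: \<epsilon>_def)
  interpret P: bounded_linear P using P by (rule has_derivative_bounded_linear)
  obtain d where d: "d > 0"
    "\<And>y. norm (y - a) < d \<Longrightarrow> norm (D y v - D a v - P (y - a)) \<le> \<epsilon> * norm (y - a)"
    using P \<epsilon> unfolding has_derivative_at_alt by blast
  obtain r where r: "r > 0" "ball a r \<subseteq> U"
    using U open_contains_ball by blast
  have "\<forall>\<^sub>F h in at_right 0. 0 < h \<and> h < min d r / K"
    using d r K by (auto simp: eventually_at_right_field intro!: exI[of _ "min d r / K"])
  then show "\<forall>\<^sub>F h in at_right 0.
      dist ((f (a + h *\<^sub>R v + h *\<^sub>R w) - f (a + h *\<^sub>R v) - f (a + h *\<^sub>R w) + f a) / h\<^sup>2) (P w) < e"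
  proof eventually_elim
    fix h :: real assume h: "0 < h \<and> h < min d r / K"
    have near: "norm (s *\<^sub>R v + t *\<^sub>R w) \<le> h * K \<and> norm (s *\<^sub>R v + t *\<^sub>R w) < min d r"
      if "0 \<le> s" "s \<le> h" "0 \<le> t" "t \<le> h" for s t
    proof -
      have "norm (s *\<^sub>R v + t *\<^sub>R w) \<le> norm (s *\<^sub>R v) + norm (t *\<^sub>R w)"
        by (rule norm_triangle_ineq)
      also have "\<dots> \<le> h * norm v + h * norm w"
        using that by (simp add: add_mono mult_right_mono)
      also have "\<dots> \<le> h * K"
        using h by (simp add: K_def algebra_simps)
      also have "h * K < min d r"
        using h K by (simp add: field_simps)
      finally have "norm (s *\<^sub>R v + t *\<^sub>R w) < min d r" .
      with \<open>norm (s *\<^sub>R v + t *\<^sub>R w) \<le> norm (s *\<^sub>R v) + norm (t *\<^sub>R w)\<close>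
        \<open>norm (s *\<^sub>R v) + norm (t *\<^sub>R w) \<le> h * norm v + h * norm w\<close>
        \<open>h * norm v + h * norm w \<le> h * K\<close>
      show ?thesis by linarith
    qed
    have inU: "a + s *\<^sub>R v + t *\<^sub>R w \<in> U" if "0 \<le> s" "s \<le> h" "0 \<le> t" "t \<le> h" for s t
    proof -
      have "dist (a + (s *\<^sub>R v + t *\<^sub>R w)) a < r"
        using near[OF that] by (simp add: dist_norm)
      then have "a + (s *\<^sub>R v + t *\<^sub>R w) \<in> ball a r" by (simp add: dist_commute)
      then show ?thesis using r(2) by (auto simp: add.assoc)
    qed
    define g where "g t = f (a + t *\<^sub>R v + h *\<^sub>R w) - f (a + t *\<^sub>R v)" for t
    have "\<exists>\<xi>\<in>{0<..<h}. g h - g 0 =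
        (\<lambda>k. D (a + \<xi> *\<^sub>R v + h *\<^sub>R w) (k *\<^sub>R v) - D (a + \<xi> *\<^sub>R v) (k *\<^sub>R v)) (h - 0)"
    proof (rule mvt_simple)
      show "0 < h" using h by simp
      fix t assume t: "0 \<le> t" "t \<le> h"
      have U1: "a + t *\<^sub>R v + h *\<^sub>R w \<in> U" using inU[of t h] t h by auto
      have U0: "a + t *\<^sub>R v \<in> U" using inU[of t 0] t h by auto
      have "((\<lambda>t. a + t *\<^sub>R v + h *\<^sub>R w) has_derivative (\<lambda>k. k *\<^sub>R v)) (at t within {0..h})"
        by (auto intro!: derivative_eq_intros)
      then have d1: "((\<lambda>t. f (a + t *\<^sub>R v + h *\<^sub>R w)) has_derivative
          (\<lambda>k. D (a + t *\<^sub>R v + h *\<^sub>R w) (k *\<^sub>R v))) (at t within {0..h})"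
        using f[OF U1]
        by (rule has_derivative_compose[where f = "\<lambda>t. a + t *\<^sub>R v + h *\<^sub>R w" and g = f])
      have "((\<lambda>t. a + t *\<^sub>R v) has_derivative (\<lambda>k. k *\<^sub>R v)) (at t within {0..h})"
        by (auto intro!: derivative_eq_intros)
      then have d0: "((\<lambda>t. f (a + t *\<^sub>R v)) has_derivative
          (\<lambda>k. D (a + t *\<^sub>R v) (k *\<^sub>R v))) (at t within {0..h})"
        using f[OF U0]
        by (rule has_derivative_compose[where f = "\<lambda>t. a + t *\<^sub>R v" and g = f])
      show "(g has_derivative
          (\<lambda>k. D (a + t *\<^sub>R v + h *\<^sub>R w) (k *\<^sub>R v) - D (a + t *\<^sub>R v) (k *\<^sub>R v))) (at t within {0..h})"
        unfolding g_def using d1 d0 by (rule has_derivative_diff)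
    qed
    then obtain \<xi> where \<xi>: "0 < \<xi>" "\<xi> < h"
      and mvt: "g h - g 0 = D (a + \<xi> *\<^sub>R v + h *\<^sub>R w) (h *\<^sub>R v) - D (a + \<xi> *\<^sub>R v) (h *\<^sub>R v)"
      by auto
    define x1 where "x1 = a + \<xi> *\<^sub>R v + h *\<^sub>R w"
    define x0 where "x0 = a + \<xi> *\<^sub>R v"
    have "x1 \<in> U" "x0 \<in> U"
      using inU[of \<xi> h] inU[of \<xi> 0] \<xi> by (auto simp: x1_def x0_def)
    then have lin: "linear (D x1)" "linear (D x0)"
      using f has_derivative_linear by blast+
    have gD: "g h - g 0 = h * (D x1 v - D x0 v)"
      using mvt lin by (simp add: x1_def x0_def linear_scale algebra_simps)
    have n1: "norm (x1 - a) \<le> h * K" "norm (x1 - a) < d"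
      using near[of \<xi> h] \<xi> by (auto simp: x1_def algebra_simps)
    have n0: "norm (x0 - a) \<le> h * K" "norm (x0 - a) < d"
      using near[of \<xi> 0] \<xi> by (auto simp: x0_def)
    have "\<epsilon> * norm (x1 - a) \<le> \<epsilon> * (h * K)" "\<epsilon> * norm (x0 - a) \<le> \<epsilon> * (h * K)"
      using n1 n0 \<epsilon> by (auto intro!: mult_left_mono)
    moreover have "P (x1 - a) - P (x0 - a) = h * P w"
      by (simp add: P.diff[symmetric] x1_def x0_def P.add P.scaleR)
    ultimately have "\<bar>(D x1 v - D x0 v) - h * P w\<bar> \<le> 2 * (\<epsilon> * (h * K))"
      using d(2)[OF n1(2)] d(2)[OF n0(2)] unfolding real_norm_def by linarith
    also have "\<dots> = h * (e / 2)"
      using K by (simp add: \<epsilon>_def)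
    also have "\<dots> < h * e"
      using h e by simp
    finally have "h * \<bar>(D x1 v - D x0 v) - h * P w\<bar> < h * (h * e)"
      using h by (intro mult_strict_left_mono) auto
    then have "\<bar>(g h - g 0) - h\<^sup>2 * P w\<bar> < h\<^sup>2 * e"
    proof -
      have "(g h - g 0) - h\<^sup>2 * P w = h * ((D x1 v - D x0 v) - h * P w)"
        by (simp add: gD algebra_simps power2_eq_square)
      then have "\<bar>(g h - g 0) - h\<^sup>2 * P w\<bar> = h * \<bar>(D x1 v - D x0 v) - h * P w\<bar>"
        using h by (simp only: abs_mult) simp
      with \<open>h * \<bar>(D x1 v - D x0 v) - h * P w\<bar> < h * (h * e)\<close> show ?thesis
        by (simp add: power2_eq_square mult.assoc)
    qed
    moreover have "\<bar>(g h - g 0) - h\<^sup>2 * P w\<bar> = h\<^sup>2 * \<bar>(g h - g 0) / h\<^sup>2 - P w\<bar>"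
    proof -
      have "(g h - g 0) - h\<^sup>2 * P w = h\<^sup>2 * ((g h - g 0) / h\<^sup>2 - P w)"
        using h by (simp add: field_simps)
      then show ?thesis by (simp add: abs_mult)
    qed
    ultimately have "\<bar>(g h - g 0) / h\<^sup>2 - P w\<bar> < e"
      using h by simp
    then show "dist ((f (a + h *\<^sub>R v + h *\<^sub>R w) - f (a + h *\<^sub>R v) - f (a + h *\<^sub>R w) + f a) / h\<^sup>2) (P w) < e"
      by (simp add: g_def dist_real_def algebra_simps)
  qed
qed

lemma second_derivative_symmetric:
  fixes f :: "'a::real_normed_vector \<Rightarrow> real"
  assumes U: "open U" "a \<in> U"
    and f: "\<And>x. x \<in> U \<Longrightarrow> (f has_derivative D x) (at x)"
    and P: "((\<lambda>x. D x v) has_derivative P) (at a)"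
    and Q: "((\<lambda>x. D x w) has_derivative Q) (at a)"
  shows "P w = Q v"
proof (rule tendsto_unique)
  let ?q = "\<lambda>h. (f (a + h *\<^sub>R v + h *\<^sub>R w) - f (a + h *\<^sub>R v) - f (a + h *\<^sub>R w) + f a) / h\<^sup>2"
  show "(?q \<longlongrightarrow> P w) (at_right 0)"
    by (rule second_difference_tendsto[OF U f P])
  have "((\<lambda>h. (f (a + h *\<^sub>R w + h *\<^sub>R v) - f (a + h *\<^sub>R w) - f (a + h *\<^sub>R v) + f a) / h\<^sup>2)
           \<longlongrightarrow> Q v) (at_right 0)"
    by (rule second_difference_tendsto[OF U f Q])
  then show "(?q \<longlongrightarrow> Q v) (at_right 0)"
    by (simp add: algebra_simps)
qed simp

section \<open>Zero sets of harmonic functions\<close>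

text \<open>
  Near a point with \<open>deriv F z \<noteq> 0\<close> the function \<open>F\<close> has a holomorphic inverse, and the zeros
  of \<open>Re F\<close> are its image of a piece of the imaginary axis. Being null is a local property.
\<close>

lemma negligible_regular_zeros_Re:
  assumes hol: "F holomorphic_on U" and "open U"
  shows "negligible {z \<in> U. Re (F z) = 0 \<and> deriv F z \<noteq> 0}" (is "negligible ?S")
proof (rule iffD2[OF locally_negligible_alt], rule ballI)
  fix \<zeta> assume \<zeta>: "\<zeta> \<in> ?S"
  then have "\<zeta> \<in> U" "deriv F \<zeta> \<noteq> 0" by auto
  then obtain r where r: "r > 0" "ball \<zeta> r \<subseteq> U" "inj_on F (ball \<zeta> r)"
    by (rule has_complex_derivative_locally_injective[OF hol _ \<open>open U\<close>])
  have holb: "F holomorphic_on ball \<zeta> r"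
    using hol r(2) by (rule holomorphic_on_subset)
  obtain g where g: "g holomorphic_on (F ` ball \<zeta> r)" "\<And>z. z \<in> ball \<zeta> r \<Longrightarrow> g (F z) = z"
    using holomorphic_has_inverse[OF holb open_ball r(3)] by metis
  have "negligible {y::complex. 1 \<bullet> y = 0}"
    by (rule negligible_hyperplane) simp
  then have "negligible {y::complex. Re y = 0}"
    by (simp add: inner_complex_def)
  then have negl: "negligible ({y::complex. Re y = 0} \<inter> F ` ball \<zeta> r)"
    by (rule negligible_subset) simp
  have "g differentiable_on ({y. Re y = 0} \<inter> F ` ball \<zeta> r)"
    using holomorphic_on_imp_differentiable_on[OF g(1)] by (rule differentiable_on_subset) simp
  then have "negligible (g ` ({y. Re y = 0} \<inter> F ` ball \<zeta> r))"
    by (intro negligible_differentiable_image_negligible[OF _ negl]) simp_all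
  moreover have "?S \<inter> ball \<zeta> r \<subseteq> g ` ({y. Re y = 0} \<inter> F ` ball \<zeta> r)"
  proof
    fix z assume z: "z \<in> ?S \<inter> ball \<zeta> r"
    then have "z = g (F z)" "F z \<in> {y. Re y = 0} \<inter> F ` ball \<zeta> r"
      using g(2)[of z] by auto
    then show "z \<in> g ` ({y. Re y = 0} \<inter> F ` ball \<zeta> r)" by (rule image_eqI)
  qed
  ultimately have "negligible (?S \<inter> ball \<zeta> r)"
    by (rule negligible_subset)
  then show "\<exists>T. openin (top_of_set ?S) T \<and> \<zeta> \<in> T \<and> negligible T"
    using \<zeta> r(1) openin_open_Int[OF open_ball] by (intro exI[of _ "?S \<inter> ball \<zeta> r"]) simp
qed

text \<open>
  Here \<open>p\<close> and \<open>q\<close> are the first partial derivatives of \<open>w\<close>, so \<open>laplace\<close> is Laplace's equation.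
  The complex gradient is used instead of a holomorphic function with real part \<open>w\<close> because
  it exists globally even when \<open>U\<close> is not simply connected, as for the exterior of a disk.
\<close>

lemma negligible_zeros_harmonic:
  fixes w p q :: "complex \<Rightarrow> real"
  assumes U: "open U" "connected U"
    and w: "\<And>z. z \<in> U \<Longrightarrow> (w has_derivative (\<lambda>h. p z * Re h + q z * Im h)) (at z)"
    and p: "\<And>z. z \<in> U \<Longrightarrow> (p has_derivative P z) (at z)"
    and q: "\<And>z. z \<in> U \<Longrightarrow> (q has_derivative Q z) (at z)"
    and laplace: "\<And>z. z \<in> U \<Longrightarrow> P z 1 + Q z \<i> = 0"
    and nonzero: "z0 \<in> U" "w z0 \<noteq> 0"
  shows "negligible {z \<in> U. w z = 0}"
proof -
  define f where "f z = Complex (p z) (- q z)" for z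
  have f': "(f has_field_derivative Complex (P z 1) (- Q z 1)) (at z)" if z: "z \<in> U" for z
  proof -
    have lin: "linear (P z)" "linear (Q z)"
      by (rule has_derivative_linear[OF p[OF z]], rule has_derivative_linear[OF q[OF z]])
    have split: "L h = L 1 * Re h + L \<i> * Im h" if "linear L" for L :: "complex \<Rightarrow> real" and h
    proof -
      have "h = Re h *\<^sub>R 1 + Im h *\<^sub>R \<i>"
        by (simp add: complex_eq_iff)
      then have "L h = L (Re h *\<^sub>R 1 + Im h *\<^sub>R \<i>)" by simp
      then show ?thesis
        using that by (simp add: linear_add linear_scale)
    qed
    have "P z \<i> = Q z 1"
      by (rule second_derivative_symmetric[OF U(1) z w]) (use p[OF z] q[OF z] in simp_all)
    moreover have "Q z \<i> = - P z 1" using laplace[OF z] by simp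
    ultimately have cr: "Complex (P z h) (- Q z h) = Complex (P z 1) (- Q z 1) * h" for h
      using split[OF lin(1), of h] split[OF lin(2), of h]
      by (simp add: complex_eq_iff algebra_simps)
    have "((\<lambda>z. of_real (p z) - \<i> * of_real (q z)) has_derivative
        (\<lambda>h. of_real (P z h) - \<i> * of_real (Q z h))) (at z)"
      by (intro derivative_intros p q z)
    moreover have "(\<lambda>z. of_real (p z) - \<i> * of_real (q z)) = f"
      by (auto simp: f_def complex_eq_iff)
    moreover have "(\<lambda>h. of_real (P z h) - \<i> * of_real (Q z h)) = (*) (Complex (P z 1) (- Q z 1))"
      by (rule ext) (simp add: cr[symmetric] complex_eq_iff)
    ultimately show ?thesis by (simp add: has_field_derivative_def)
  qed
  have hol: "f holomorphic_on U"
    unfolding holomorphic_on_open[OF U(1)] using f' by blast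
  have crit: "w z0 = w z" if "\<forall>z\<in>U. f z = 0" "z \<in> U" for z
  proof (rule has_derivative_zero_unique_connected[OF U])
    fix y assume y: "y \<in> U"
    then have "p y = 0" "q y = 0"
      using that by (auto simp: f_def complex_eq_iff)
    with w[OF y] show "(w has_derivative (\<lambda>x. 0)) (at y)" by simp
  qed (use nonzero that in auto)
  have reg: "negligible {z \<in> U. w z = 0 \<and> f z \<noteq> 0}" (is "negligible ?R")
  proof (rule iffD2[OF locally_negligible_alt], rule ballI)
    fix \<zeta> assume \<zeta>: "\<zeta> \<in> ?R"
    then obtain r where r: "r > 0" "ball \<zeta> r \<subseteq> U"
      using openE[OF U(1), of \<zeta>] by auto
    obtain F where F: "\<And>z. z \<in> ball \<zeta> r \<Longrightarrow> (F has_field_derivative f z) (at z within ball \<zeta> r)"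
      using holomorphic_convex_primitive'[OF convex_ball open_ball holomorphic_on_subset[OF hol r(2)]]
      by metis
    have F': "(F has_field_derivative f z) (at z)" if "z \<in> ball \<zeta> r" for z
      using F[OF that] at_within_open[OF that open_ball] by simp
    have "((\<lambda>z. w z - Re (F z)) has_derivative (\<lambda>h. 0)) (at z)" if z: "z \<in> ball \<zeta> r" for z
    proof -
      have "((\<lambda>z. w z - Re (F z)) has_derivative
          (\<lambda>h. (p z * Re h + q z * Im h) - Re (f z * h))) (at z)"
        using F'[OF z] z r unfolding has_field_derivative_def
        by (intro has_derivative_diff w has_derivative_Re) auto
      then show ?thesis by (simp add: f_def)
    qed
    then have "\<And>z. z \<in> ball \<zeta> r \<Longrightarrow> w z - Re (F z) = w \<zeta> - Re (F \<zeta>)"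
      using r(1) by (intro has_derivative_zero_unique_connected[OF open_ball connected_ball,
            where f = "\<lambda>z. w z - Re (F z)"]) auto
    then obtain c where c: "\<And>z. z \<in> ball \<zeta> r \<Longrightarrow> w z = Re (F z + of_real c)"
      by (auto simp: algebra_simps intro: that[of "w \<zeta> - Re (F \<zeta>)"])
    have D: "((\<lambda>z. F z + of_real c) has_field_derivative f z) (at z)" if "z \<in> ball \<zeta> r" for z
      using F'[OF that] by (auto intro!: derivative_eq_intros)
    have "negligible {z \<in> ball \<zeta> r. Re (F z + of_real c) = 0 \<and> deriv (\<lambda>z. F z + of_real c) z \<noteq> 0}"
      by (rule negligible_regular_zeros_Re) (use D holomorphic_on_open[OF open_ball] in blast, simp)
    then have "negligible (?R \<inter> ball \<zeta> r)"
      by (rule negligible_subset) (use c DERIV_imp_deriv[OF D] in auto)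
    then show "\<exists>T. openin (top_of_set ?R) T \<and> \<zeta> \<in> T \<and> negligible T"
      using \<zeta> r(1) openin_open_Int[OF open_ball] by (intro exI[of _ "?R \<inter> ball \<zeta> r"]) simp
  qed
  show ?thesis
  proof (cases "\<forall>z\<in>U. f z = 0")
    case True
    have "w z \<noteq> 0" if "z \<in> U" for z
      using crit[OF True that] nonzero(2) by metis
    then have none: "{z \<in> U. w z = 0} = {}" by blast
    show ?thesis unfolding none by (rule negligible_empty)
  next
    case False
    have "countable {z \<in> U. f z = 0}"
    proof (cases "f constant_on U")
      case True
      with False have none: "{z \<in> U. f z = 0} = {}" by (auto simp: constant_on_def)
      show ?thesis unfolding none by (rule countable_empty)
    next
      case False
      obtain C :: "nat \<Rightarrow> complex set" where "\<And>n. compact (C n)" "\<Union> (range C) = U"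
        using open_Union_compact_subsets[OF U(1)] by metis
      then have "fsigma U"
        using fsigma.intros[of C] compact_imp_closed by auto
      with False show ?thesis
        by (intro holomorphic_countable_zeros[OF hol U])
    qed
    then have "negligible {z \<in> U. f z = 0}"
      using countable_imp_null_set_lborel null_sets_completionI negligible_iff_null_sets by blast
    then have "negligible ({z \<in> U. f z = 0} \<union> ?R)"
      using reg by (rule negligible_Un)
    then show ?thesis by (rule negligible_subset) auto
  qed
qed

section \<open>Derivatives within the two domains\<close>

lemma has_derivative_pd:
  assumes S: "S = ball 0 1 \<or> S = - ball 0 1" and x: "x \<in> S" and f: "f differentiable_on S"
  shows "(f has_derivative (\<lambda>h. pd S 1 f x * h $ 1 + pd S 2 f x * h $ 2)) (at x within S)"
proof -
  obtain D where D: "(f has_derivative D) (at x within S)"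
    using f x unfolding differentiable_on_def differentiable_def by blast
  have "D h = pd S 1 f x * h $ 1 + pd S 2 f x * h $ 2" for h
  proof -
    have "h = h $ 1 *\<^sub>R axis 1 1 + h $ 2 *\<^sub>R axis 2 1"
      by (simp add: vec_eq_iff forall_2 axis_def)
    then have "D h = D (h $ 1 *\<^sub>R axis 1 1 + h $ 2 *\<^sub>R axis 2 1)" by simp
    also have "\<dots> = h $ 1 * D (axis 1 1) + h $ 2 * D (axis 2 1)"
      using has_derivative_linear[OF D] by (simp add: linear_add linear_scale)
    finally show ?thesis using pd_eqI[OF S x D] by simp
  qed
  then have "D = (\<lambda>h. pd S 1 f x * h $ 1 + pd S 2 f x * h $ 2)" ..
  with D show ?thesis by simp
qed

definition vec_of_complex :: "complex \<Rightarrow> real^2" where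
  "vec_of_complex z = (\<chi> i. if i = 1 then Re z else Im z)"

lemma vec_of_complex_nth [simp]: "vec_of_complex z $ 1 = Re z" "vec_of_complex z $ 2 = Im z"
  by (simp_all add: vec_of_complex_def)

lemma linear_vec_of_complex: "linear vec_of_complex"
  by (rule linearI) (simp_all add: vec_eq_iff forall_2)

lemma vec_of_complex_Complex: "vec_of_complex (Complex (x $ 1) (x $ 2)) = x"
  by (simp add: vec_eq_iff forall_2)

text \<open>
  What allows passing from the exterior, a closed set, to its interior: identity arguments need
  a connected open set, density lets the interior detect a nonzero continuous function,
  and the remaining circle is null.
\<close>

lemma interior_domain:
  fixes S :: "(real^2) set"
  assumes S: "S = ball 0 1 \<or> S = - ball 0 1"
  shows "connected (interior S)" "S \<subseteq> closure (interior S)" "negligible (S - interior S)"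
proof -
  have int: "interior (- ball (0::real^2) 1) = - cball 0 1"
    by (simp add: interior_complement)
  have cl: "closure (- cball (0::real^2) 1) = - ball 0 1"
    by (simp add: closure_complement)
  show "connected (interior S)"
    using S int connected_complement_bounded_convex[of "cball (0::real^2) 1"] by auto
  show "S \<subseteq> closure (interior S)"
    using S int cl closure_subset[of "ball (0::real^2) 1"] by auto
  have "S - interior S \<subseteq> sphere 0 1"
    using S int by auto
  then show "negligible (S - interior S)"
    using negligible_sphere negligible_subset by blast
qed

lemma negligible_zeros_harmonic_domain:
  fixes S :: "(real^2) set"
  assumes S: "S = ball 0 1 \<or> S = - ball 0 1"
    and reg: "twice_differentiable_on u S"
    and lap: "\<And>x. x \<in> S \<Longrightarrow> laplacian S u x = 0"
    and nz: "x \<in> S" "u x \<noteq> 0"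
  shows "negligible {x \<in> S. u x = 0}"
proof -
  define V where "V = interior S"
  define U where "U = vec_of_complex -` V"
  have du: "u differentiable_on S" and dpd: "\<And>i. pd S i u differentiable_on S"
    using reg by (auto simp: twice_differentiable_on_def)
  have VS: "V \<subseteq> S" unfolding V_def by (rule interior_subset)
  have cont: "continuous_on A vec_of_complex" for A
    using linear_vec_of_complex linear_continuous_on linear_conv_bounded_linear by blast
  have "open U"
    unfolding U_def V_def by (rule open_vimage[OF open_interior cont])
  have "continuous_on V (\<lambda>x. Complex (x $ 1) (x $ 2))"
    by (intro continuous_intros)
  then have "connected ((\<lambda>x. Complex (x $ 1) (x $ 2)) ` V)"
    using connected_continuous_image interior_domain(1)[OF S] V_def by blast
  moreover have "(\<lambda>x. Complex (x $ 1) (x $ 2)) ` V = U"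
  proof
    show "(\<lambda>x. Complex (x $ 1) (x $ 2)) ` V \<subseteq> U"
      by (auto simp: U_def vec_of_complex_Complex)
    show "U \<subseteq> (\<lambda>x. Complex (x $ 1) (x $ 2)) ` V"
      by (auto simp: U_def image_iff complex_eq_iff intro!: bexI[of _ "vec_of_complex _"])
  qed
  ultimately have "connected U" by simp
  have chain: "((\<lambda>z. f (vec_of_complex z)) has_derivative
      (\<lambda>h. pd S 1 f (vec_of_complex z) * Re h + pd S 2 f (vec_of_complex z) * Im h)) (at z)"
    if "f differentiable_on S" "z \<in> U" for f z
  proof -
    have "vec_of_complex z \<in> V" using that U_def by auto
    then have "at (vec_of_complex z) within S = at (vec_of_complex z)"
      unfolding V_def by (rule at_within_interior)
    then have "(f has_derivative (\<lambda>h. pd S 1 f (vec_of_complex z) * h $ 1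
        + pd S 2 f (vec_of_complex z) * h $ 2)) (at (vec_of_complex z))"
      using has_derivative_pd[OF S _ that(1), of "vec_of_complex z"] \<open>vec_of_complex z \<in> V\<close> VS
      by auto
    from has_derivative_compose[OF linear_imp_has_derivative[OF linear_vec_of_complex] this]
    show ?thesis by simp
  qed
  \<comment> \<open>The point \<open>x\<close> may lie on the boundary circle; continuity moves it inside.\<close>
  have "\<exists>y\<in>V. u y \<noteq> 0"
  proof (rule ccontr)
    assume "\<not> (\<exists>y\<in>V. u y \<noteq> 0)"
    then have 0: "\<And>y. y \<in> V \<Longrightarrow> u y = 0" by blast
    have "continuous_on S u" using du by (rule differentiable_imp_continuous_on)
    then have "closedin (top_of_set S) {y \<in> S. u y = 0}"
      by (rule continuous_closedin_preimage_constant)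
    then obtain C where C: "closed C" "{y \<in> S. u y = 0} = S \<inter> C"
      by (auto simp: closedin_closed)
    have "V \<subseteq> C" using 0 VS C(2) by blast
    then have "S \<subseteq> C"
      using closure_minimal[OF _ C(1)] interior_domain(2)[OF S] V_def by blast
    with C(2) nz have "u x = 0" by blast
    with nz show False by simp
  qed
  then obtain y where y: "y \<in> V" "u y \<noteq> 0" by blast
  have "negligible {z \<in> U. u (vec_of_complex z) = 0}"
  proof (rule negligible_zeros_harmonic[OF \<open>open U\<close> \<open>connected U\<close> chain[OF du] chain[OF dpd] chain[OF dpd]])
    fix z assume "z \<in> U"
    then have "laplacian S u (vec_of_complex z) = 0"
      using lap VS by (auto simp: U_def)
    then show "pd S 1 (pd S 1 u) (vec_of_complex z) * Re 1 + pd S 2 (pd S 1 u) (vec_of_complex z) * Im 1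
      + (pd S 1 (pd S 2 u) (vec_of_complex z) * Re \<i> + pd S 2 (pd S 2 u) (vec_of_complex z) * Im \<i>) = 0"
      by (simp add: laplacian_def sum_2)
  next
    show "Complex (y $ 1) (y $ 2) \<in> U" "u (vec_of_complex (Complex (y $ 1) (y $ 2))) \<noteq> 0"
      using y by (simp_all add: U_def vec_of_complex_Complex)
  qed
  then have "negligible (vec_of_complex ` {z \<in> U. u (vec_of_complex z) = 0})"
    by (intro negligible_differentiable_image_negligible linear_imp_differentiable_on
        linear_vec_of_complex) simp_all
  moreover have "{x \<in> S. u x = 0} \<subseteq> vec_of_complex ` {z \<in> U. u (vec_of_complex z) = 0} \<union> (S - V)"
  proof
    fix x assume x: "x \<in> {x \<in> S. u x = 0}"
    then show "x \<in> vec_of_complex ` {z \<in> U. u (vec_of_complex z) = 0} \<union> (S - V)"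
      by (auto simp: U_def vec_of_complex_Complex
          intro!: image_eqI[of _ _ "Complex (x $ 1) (x $ 2)"])
  qed
  ultimately show ?thesis
    using interior_domain(3)[OF S] negligible_subset negligible_Un unfolding V_def by blast
qed

section \<open>The minimal conditions force proportional gradients\<close>

text \<open>
  Dependence makes one vector a multiple of the other, say \<open>b = k a\<close>, and then the norm
  identity reads \<open>(s k)\<^sup>2 = t\<^sup>2\<close> unless \<open>a = 0\<close>.
\<close>

lemma grad_dichotomy:
  fixes a b :: "'a::real_inner"
  assumes eq: "\<bar>s\<bar>\<^sup>2 * (norm b)\<^sup>2 = \<bar>t\<bar>\<^sup>2 * (norm a)\<^sup>2" and dep: "lin_dep_pair a b"
  shows "s *\<^sub>R b = t *\<^sub>R a \<or> s *\<^sub>R b = - (t *\<^sub>R a)"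
proof -
  have *: "s *\<^sub>R (k *\<^sub>R c) = t *\<^sub>R c \<or> s *\<^sub>R (k *\<^sub>R c) = - (t *\<^sub>R c)"
    if "s\<^sup>2 * (norm (k *\<^sub>R c))\<^sup>2 = t\<^sup>2 * (norm c)\<^sup>2" for s t k and c :: 'a
  proof (cases "c = 0")
    case False
    then have "(s * k)\<^sup>2 = t\<^sup>2"
      using that by (simp add: power_mult_distrib)
    then have "s * k = t \<or> s * k = - t" by (simp add: power2_eq_iff)
    then show ?thesis by (metis scaleR_minus_left scaleR_scaleR)
  qed simp
  obtain \<alpha> \<beta> where ab: "\<alpha> \<noteq> 0 \<or> \<beta> \<noteq> 0" "\<alpha> *\<^sub>R a + \<beta> *\<^sub>R b = 0"
    using dep unfolding lin_dep_pair_def by blast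
  show ?thesis
  proof (cases "\<beta> = 0")
    case True
    with ab have "a = 0 *\<^sub>R b" by simp
    with *[of t 0 b s] eq show ?thesis by auto
  next
    case False
    have "\<beta> *\<^sub>R b = - (\<alpha> *\<^sub>R a)" using ab(2) by (simp add: eq_neg_iff_add_eq_0 add.commute)
    then have "(1 / \<beta>) *\<^sub>R (\<beta> *\<^sub>R b) = (1 / \<beta>) *\<^sub>R (- (\<alpha> *\<^sub>R a))" by simp
    with False have "b = (- \<alpha> / \<beta>) *\<^sub>R a" by simp
    with *[of s "- \<alpha> / \<beta>" a t] eq show ?thesis by auto
  qed
qed

theorem theorem4:
  fixes \<Omega> :: "(real^2) set" and u v :: "real^2 \<Rightarrow> real"
  assumes dom: "\<Omega> = ball 0 1 \<or> \<Omega> = - ball 0 1"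
    and reg_u: "twice_differentiable_on u \<Omega>"
    and reg_v: "twice_differentiable_on v \<Omega>"
    and eq_u: "\<And>x. x \<in> \<Omega> \<Longrightarrow>
      - laplacian \<Omega> u x =
        (2 * u x * (pd \<Omega> 1 v x)\<^sup>2 + 2 * u x * (pd \<Omega> 2 v x)\<^sup>2
          - 2 * pd \<Omega> 1 u x * pd \<Omega> 1 v x * v x - 2 * pd \<Omega> 2 u x * pd \<Omega> 2 v x * v x)
        / (1 + (u x)\<^sup>2 + (v x)\<^sup>2)"
    and eq_v: "\<And>x. x \<in> \<Omega> \<Longrightarrow>
      - laplacian \<Omega> v x =
        (2 * v x * (pd \<Omega> 1 u x)\<^sup>2 + 2 * v x * (pd \<Omega> 2 u x)\<^sup>2
          - 2 * pd \<Omega> 1 u x * pd \<Omega> 1 v x * u x - 2 * pd \<Omega> 2 u x * pd \<Omega> 2 v x * u x)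
        / (1 + (u x)\<^sup>2 + (v x)\<^sup>2)"
    and min_a: "\<And>x. x \<in> \<Omega> \<Longrightarrow>
      \<bar>u x\<bar>\<^sup>2 * (norm (grad \<Omega> v x))\<^sup>2 = \<bar>v x\<bar>\<^sup>2 * (norm (grad \<Omega> u x))\<^sup>2"
    and min_b: "\<And>x. x \<in> \<Omega> \<Longrightarrow> lin_dep_pair (grad \<Omega> u x) (grad \<Omega> v x)"
  shows "(\<forall>x \<in> \<Omega> - {x \<in> \<Omega>. u x = 0 \<or> v x = 0}. laplacian \<Omega> u x = 0 \<and> laplacian \<Omega> v x = 0)
    \<and> negligible {x \<in> \<Omega>. \<not> (laplacian \<Omega> u x = 0 \<and> laplacian \<Omega> v x = 0)}
    \<and> ((\<exists>x \<in> \<Omega>. u x \<noteq> 0) \<and> (\<exists>x \<in> \<Omega>. v x \<noteq> 0)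
        \<longrightarrow> negligible {x \<in> \<Omega>. u x = 0 \<or> v x = 0})"
proof -
  have du: "u differentiable_on \<Omega>" and dpu: "\<And>i. pd \<Omega> i u differentiable_on \<Omega>"
    and dv: "v differentiable_on \<Omega>" and dpv: "\<And>i. pd \<Omega> i v differentiable_on \<Omega>"
    using reg_u reg_v by (auto simp: twice_differentiable_on_def)
  define W where "W x = 1 + (u x)\<^sup>2 + (v x)\<^sup>2" for x
  have W: "W x > 0" for x unfolding W_def by (simp add: add_pos_nonneg)
  have lap_u: "W x * laplacian \<Omega> u x
      = - 2 * (\<Sum>i\<in>UNIV. pd \<Omega> i v x * (u x * pd \<Omega> i v x - v x * pd \<Omega> i u x))"
    and lap_v: "W x * laplacian \<Omega> v x
      = - 2 * (\<Sum>i\<in>UNIV. pd \<Omega> i u x * (v x * pd \<Omega> i u x - u x * pd \<Omega> i v x))"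
    if "x \<in> \<Omega>" for x
    using eq_u[OF that] eq_v[OF that] W[of x] unfolding W_def sum_2
    by (simp_all add: field_simps power2_eq_square)
  have alt: "(\<forall>i. u x * pd \<Omega> i v x = v x * pd \<Omega> i u x) \<or> (\<forall>i. u x * pd \<Omega> i v x = - v x * pd \<Omega> i u x)"
    if "x \<in> \<Omega>" for x
    using grad_dichotomy[OF min_a[OF that] min_b[OF that]] by (simp add: grad_def vec_eq_iff)
  have cross: "u x * pd \<Omega> i v x = v x * pd \<Omega> i u x" if x: "x \<in> \<Omega>" for x i
  proof (rule ccontr)
    assume ne: "u x * pd \<Omega> i v x \<noteq> v x * pd \<Omega> i u x"
    have "continuous_on \<Omega> (\<lambda>y. u y * pd \<Omega> i v y - v y * pd \<Omega> i u y)"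
      by (intro continuous_intros differentiable_imp_continuous_on du dv dpu dpv)
    then have "((\<lambda>y. u y * pd \<Omega> i v y - v y * pd \<Omega> i u y) \<longlongrightarrow>
        u x * pd \<Omega> i v x - v x * pd \<Omega> i u x) (at x within \<Omega>)"
      using x by (simp add: continuous_on_def)
    then have "\<forall>\<^sub>F y in at x within \<Omega>. u y * pd \<Omega> i v y - v y * pd \<Omega> i u y \<noteq> 0"
      by (rule tendsto_imp_eventually_ne) (use ne in simp)
    then have ev: "\<forall>\<^sub>F y in at x within \<Omega>. \<forall>j. u y * pd \<Omega> j v y + v y * pd \<Omega> j u y = 0"
      unfolding eventually_at_filter by eventually_elim (use alt in force)
    have neg: "\<forall>j. u x * pd \<Omega> j v x + v x * pd \<Omega> j u x = 0"
      using alt[OF x] ne by force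
    \<comment> \<open>The field \<open>u \<nabla>v + v \<nabla>u\<close> vanishes near \<open>x\<close> within \<open>\<Omega>\<close>, and derivatives within \<open>\<Omega>\<close> are
      unique also at boundary points; the sum over \<open>j\<close> is the divergence of this field.\<close>
    have div: "pd \<Omega> j u x * pd \<Omega> j v x + u x * pd \<Omega> j (pd \<Omega> j v) x
        + (pd \<Omega> j v x * pd \<Omega> j u x + v x * pd \<Omega> j (pd \<Omega> j u) x) = 0" for j
    proof -
      let ?D = "\<lambda>f (h::real^2). pd \<Omega> 1 f x * h $ 1 + pd \<Omega> 2 f x * h $ 2"
      let ?g = "\<lambda>y. u y * pd \<Omega> j v y + v y * pd \<Omega> j u y"
      have pdD: "?D f (axis j 1) = pd \<Omega> j f x" for f
        using exhaust_2[of j] by (auto simp: axis_def)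
      have "(?g has_derivative (\<lambda>h. (u x * ?D (pd \<Omega> j v) h + ?D u h * pd \<Omega> j v x)
          + (v x * ?D (pd \<Omega> j u) h + ?D v h * pd \<Omega> j u x))) (at x within \<Omega>)"
        by (intro has_derivative_add has_derivative_mult has_derivative_pd dom x du dv dpu dpv)
      from pd_eqI[OF dom x this, of j]
      have "pd \<Omega> j ?g x = (u x * pd \<Omega> j (pd \<Omega> j v) x + pd \<Omega> j u x * pd \<Omega> j v x)
          + (v x * pd \<Omega> j (pd \<Omega> j u) x + pd \<Omega> j v x * pd \<Omega> j u x)"
        unfolding pdD .
      moreover have "(?g has_derivative (\<lambda>h. 0)) (at x within \<Omega>)"
        by (rule has_derivative_transform_eventually[OF has_derivative_const, of 0])
          (use ev neg x in \<open>auto elim: eventually_mono\<close>)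
      then have "pd \<Omega> j ?g x = 0" by (rule pd_eqI[OF dom x])
      ultimately show ?thesis by (simp add: algebra_simps)
    qed
    define A where "A = (\<Sum>j\<in>UNIV. (pd \<Omega> j u x)\<^sup>2)"
    define B where "B = (\<Sum>j\<in>UNIV. (pd \<Omega> j v x)\<^sup>2)"
    define C where "C = (\<Sum>j\<in>UNIV. pd \<Omega> j u x * pd \<Omega> j v x)"
    have neg': "u x * pd \<Omega> j v x = - (v x * pd \<Omega> j u x)" for j
      using neg by (simp add: eq_neg_iff_add_eq_0)
    have "W x * laplacian \<Omega> u x = - 2 * (\<Sum>j\<in>UNIV. pd \<Omega> j v x * (2 * (u x * pd \<Omega> j v x)))"
      unfolding lap_u[OF x] neg' by simp
    then have LU: "W x * laplacian \<Omega> u x = - 4 * u x * B"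
      unfolding B_def sum_2 by (simp add: algebra_simps power2_eq_square)
    have "W x * laplacian \<Omega> v x = - 2 * (\<Sum>j\<in>UNIV. pd \<Omega> j u x * (2 * (v x * pd \<Omega> j u x)))"
      unfolding lap_v[OF x] neg' by simp
    then have LV: "W x * laplacian \<Omega> v x = - 4 * v x * A"
      unfolding A_def sum_2 by (simp add: algebra_simps power2_eq_square)
    have "2 * C + u x * laplacian \<Omega> v x + v x * laplacian \<Omega> u x = 0"
      using div[of 1] div[of 2] unfolding C_def laplacian_def sum_2 by (simp add: algebra_simps)
    then have "W x * (2 * C) + u x * (W x * laplacian \<Omega> v x) + v x * (W x * laplacian \<Omega> u x) = 0"
      by (metis (no_types, opaque_lifting) distrib_left mult.left_commute mult_zero_right)
    then have "W x * C = 2 * (u x * v x) * (A + B)"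
      unfolding LU LV by (simp add: algebra_simps)
    \<comment> \<open>The factor \<open>u v\<close> makes the sign of both sides visible.\<close>
    then have "W x * (u x * v x * C) = 2 * (u x * v x)\<^sup>2 * (A + B)"
      by (simp add: power2_eq_square)
    moreover have "u x * v x * C = - ((v x)\<^sup>2 * A)"
    proof -
      have "u x * v x * C = v x * (\<Sum>j\<in>UNIV. pd \<Omega> j u x * (u x * pd \<Omega> j v x))"
        unfolding C_def sum_2 by (simp add: algebra_simps)
      also have "\<dots> = - ((v x)\<^sup>2 * A)"
        unfolding neg' A_def sum_2 by (simp add: algebra_simps power2_eq_square)
      finally show ?thesis .
    qed
    moreover have "A \<ge> 0" "B \<ge> 0" unfolding A_def B_def by (simp_all add: sum_nonneg)
    ultimately have "W x * ((v x)\<^sup>2 * A) \<le> 0"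
      by (smt (verit) mult_minus_right mult_nonneg_nonneg zero_le_power2)
    then have "(v x)\<^sup>2 * A \<le> 0" using W[of x] by (simp add: mult_le_0_iff)
    then have "(\<Sum>j\<in>UNIV. (v x * pd \<Omega> j u x)\<^sup>2) \<le> 0"
      by (simp add: A_def sum_distrib_left power_mult_distrib)
    moreover have "(v x * pd \<Omega> i u x)\<^sup>2 \<le> (\<Sum>j\<in>UNIV. (v x * pd \<Omega> j u x)\<^sup>2)"
      by (rule member_le_sum) auto
    ultimately have "(v x * pd \<Omega> i u x)\<^sup>2 \<le> 0" by linarith
    then have "v x * pd \<Omega> i u x = 0" by simp
    with ne neg'[of i] show False by simp
  qed
  have harm: "laplacian \<Omega> u x = 0" "laplacian \<Omega> v x = 0" if "x \<in> \<Omega>" for x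
    using lap_u[OF that] lap_v[OF that] W[of x] by (simp_all add: cross[OF that])
  have "negligible {x \<in> \<Omega>. u x = 0 \<or> v x = 0}"
    if "\<exists>x\<in>\<Omega>. u x \<noteq> 0" "\<exists>x\<in>\<Omega>. v x \<noteq> 0"
  proof -
    have "negligible ({x \<in> \<Omega>. u x = 0} \<union> {x \<in> \<Omega>. v x = 0})"
      using that negligible_zeros_harmonic_domain[OF dom reg_u harm(1)]
        negligible_zeros_harmonic_domain[OF dom reg_v harm(2)] by auto
    then show ?thesis by (rule negligible_subset) auto
  qed
  moreover have "negligible {x \<in> \<Omega>. \<not> (laplacian \<Omega> u x = 0 \<and> laplacian \<Omega> v x = 0)}"
  proof -
    have none: "{x \<in> \<Omega>. \<not> (laplacian \<Omega> u x = 0 \<and> laplacian \<Omega> v x = 0)} = {}"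
      using harm by blast
    show ?thesis unfolding none by (rule negligible_empty)
  qed
  ultimately show ?thesis using harm by blast
qed

end
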